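(* Let $a_0=0$ and let $(a_n)_{n\ge 1}$ be the increasing sequence of positive integers whose odd part is of the form $4k+1$. Let $d_n=a_{n+1}-a_n$ for $n\ge 0$. Then $(d_n)_{n\ge 0}$ is not $q$-automatic for any integer $q\ge 2$.
   Context: The odd part of a positive integer $m$ is $m/2^v$ with $2^v$ the largest power of $2$ dividing $m$. A sequence $(x_n)_{n\ge0}$ is $q$-automatic if its $q$-kernel $\{(x_{q^in+j})_{n\ge 0} : i\ge 0,\ 0\le j\le q^i-1\}$ is finite. *)

theory Defs
  imports "HOL-Computational_Algebra.Primes" "HOL-Library.Infinite_Set"
begin

definition odd_part :: "nat \<Rightarrow> nat" where
  "odd_part m = m div 2 ^ multiplicity 2 m"

definition odd_part_1_mod_4 :: "nat set" where
  "odd_part_1_mod_4 = {m. 0 < m \<and> (\<exists>k. odd_part m = 4 * k + 1)}"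

(* The library function enumerate lists the elements of an infinite set of naturals
   in increasing order, starting at index 0; hence the shift by one.
   The lemmas below confirm that this is the intended sequence. *)
definition a_seq :: "nat \<Rightarrow> nat" where
  "a_seq n = (case n of 0 \<Rightarrow> 0 | Suc k \<Rightarrow> enumerate odd_part_1_mod_4 k)"

definition d_seq :: "nat \<Rightarrow> int" where
  "d_seq n = int (a_seq (n + 1)) - int (a_seq n)"

definition kernel :: "nat \<Rightarrow> (nat \<Rightarrow> 'a) \<Rightarrow> (nat \<Rightarrow> 'a) set" where
  "kernel q x = {(\<lambda>n. x (q ^ i * n + j)) | i j. j \<le> q ^ i - 1}"

definition automatic :: "nat \<Rightarrow> (nat \<Rightarrow> 'a) \<Rightarrow> bool" where
  "automatic q x \<longleftrightarrow> finite (kernel q x)"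

lemma infinite_odd_part_1_mod_4: "infinite odd_part_1_mod_4"
proof -
  have "2 ^ n \<in> odd_part_1_mod_4" for n :: nat
    by (simp add: odd_part_1_mod_4_def odd_part_def multiplicity_same_power)
  then have "range (\<lambda>n::nat. 2 ^ n :: nat) \<subseteq> odd_part_1_mod_4"
    by auto
  moreover have "infinite (range (\<lambda>n::nat. 2 ^ n :: nat))"
    by (rule range_inj_infinite) (simp add: inj_on_def)
  ultimately show ?thesis
    using finite_subset by blast
qed

lemma a_seq_0: "a_seq 0 = 0"
  by (simp add: a_seq_def)

lemma strict_mono_a_seq: "strict_mono a_seq"
proof (rule strict_mono_Suc_iff[THEN iffD2], rule allI)
  fix n
  show "a_seq n < a_seq (Suc n)"
  proof (cases n)
    case 0
    have "enumerate odd_part_1_mod_4 0 \<in> odd_part_1_mod_4"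
      by (rule enumerate_in_set[OF infinite_odd_part_1_mod_4])
    then show ?thesis
      using 0 by (simp add: a_seq_def odd_part_1_mod_4_def)
  next
    case (Suc k)
    then show ?thesis
      using enumerate_step[OF infinite_odd_part_1_mod_4] by (simp add: a_seq_def)
  qed
qed

lemma a_seq_image: "a_seq ` {1..} = odd_part_1_mod_4"
proof -
  have "a_seq ` {1..} = a_seq ` range Suc"
    by (metis One_nat_def atLeast_Suc_greaterThan greaterThan_0)
  also have "\<dots> = range (enumerate odd_part_1_mod_4)"
    by (simp add: image_image a_seq_def)
  finally show ?thesis
    using range_enumerate[OF infinite_odd_part_1_mod_4] by simp
qed

end

theory Submission
  imports Defs "HOL-Library.FuncSet"
begin

text \<open>
  Write \<open>S\<close> for the set of positive integers with odd part \<open>1\<close> mod \<open>4\<close> and \<open>A\<close> for its counting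
  function. If \<open>X\<close> is divisible by a large power of two, then \<open>S\<close> looks the same to the right of
  \<open>X\<close> and to the right of \<open>0\<close>, so \<open>d\<close> from index \<open>A(X)\<close> on repeats a long prefix of \<open>d\<close>.
  If \<open>d\<close> were \<open>q\<close>-automatic, only boundedly many different blocks would occur
  at the indices \<open>q\<^sup>k m, \<dots>, q\<^sup>k m + q\<^sup>k - 1\<close>, uniformly in \<open>k\<close>. Given enough points \<open>X\<close> whose
  values \<open>A(X)\<close> are pairwise incongruent modulo \<open>q\<^sup>k\<close>, two of them see equal blocks at
  different but close offsets, so that \<open>d\<close> has a factor of length at least three times a period.
  This is impossible: \<open>S\<close> would have a period \<open>P = 2\<^sup>v u\<close>, \<open>u\<close> odd, on an interval
  of length \<open>3 P\<close>, but for odd \<open>y\<close> exactly one of \<open>2\<^sup>v y\<close> and \<open>2\<^sup>v y + 2 P\<close> lies in \<open>S\<close>.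

  If \<open>q\<close> is not a power of two, take \<open>X = 2\<^sup>L\<close>, where \<open>A(X) = 2\<^bsup>L-1\<^esup> + 1\<close>; otherwise take
  \<open>X = 2\<^bsup>l+1\<^esup> (4\<^sup>j - 1) / 3\<close>, where \<open>A(X)\<close> is \<open>j\<close> modulo \<open>2\<^sup>l\<close>.
\<close>

section \<open>The counting function\<close>

lemma zero_notin_S: "0 \<notin> odd_part_1_mod_4"
  by (simp add: odd_part_1_mod_4_def)

lemma double_in_S_iff: "2 * m \<in> odd_part_1_mod_4 \<longleftrightarrow> m \<in> odd_part_1_mod_4"
proof (cases "m = 0")
  case False
  then have "multiplicity 2 (2 * m) = Suc (multiplicity 2 m)"
    by (simp add: multiplicity_times_same)
  then have "odd_part (2 * m) = odd_part m"
    by (simp add: odd_part_def)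
  then show ?thesis
    by (simp add: odd_part_1_mod_4_def)
qed simp

lemma odd_in_S_iff:
  assumes "odd m"
  shows "m \<in> odd_part_1_mod_4 \<longleftrightarrow> m mod 4 = 1"
proof -
  have "odd_part m = m"
    using assms by (simp add: odd_part_def not_dvd_imp_multiplicity_0)
  moreover have "(\<exists>k. m = 4 * k + 1) \<longleftrightarrow> m mod 4 = 1"
    by presburger
  ultimately show ?thesis
    using assms by (auto simp: odd_part_1_mod_4_def intro: Nat.gr0I)
qed

lemma power_mult_in_S_iff: "2 ^ v * m \<in> odd_part_1_mod_4 \<longleftrightarrow> m \<in> odd_part_1_mod_4"
proof (induction v)
  case (Suc v)
  have "2 ^ Suc v * m = 2 * (2 ^ v * m)"
    by simp
  then show ?case
    using Suc double_in_S_iff by metis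
qed simp

text \<open>As \<open>j < 2 ^ l\<close>, the shift is divisible by four times the power of two in
  \<open>j\<close>, so the odd part of \<open>j\<close> changes by a multiple of 4. The induction
  halves \<open>j\<close> until it is odd.\<close>

lemma in_S_shift_iff:
  assumes "0 < j" "j < 2 ^ l"
  shows "2 ^ Suc l * m + j \<in> odd_part_1_mod_4 \<longleftrightarrow> j \<in> odd_part_1_mod_4"
  using assms
proof (induction l arbitrary: j)
  case (Suc l)
  show ?case
  proof (cases "even j")
    case True
    then obtain i where i: "j = 2 * i"
      by blast
    have eq: "2 ^ Suc (Suc l) * m + j = 2 * (2 ^ Suc l * m + i)"
      by (simp add: i)
    have "0 < i" "i < 2 ^ l"
      using Suc.prems i by auto
    then have "2 ^ Suc l * m + i \<in> odd_part_1_mod_4 \<longleftrightarrow> i \<in> odd_part_1_mod_4"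
      by (rule Suc.IH)
    then show ?thesis
      using i double_in_S_iff unfolding eq by metis
  next
    case False
    have "2 ^ Suc (Suc l) * m + j = 4 * (2 ^ l * m) + j"
      by simp
    then have "odd (2 ^ Suc (Suc l) * m + j)" "(2 ^ Suc (Suc l) * m + j) mod 4 = j mod 4"
      using False by (simp, metis mod_mult_self4)
    then show ?thesis
      using False odd_in_S_iff by metis
  qed
qed simp

definition count_S :: "nat \<Rightarrow> nat" where
  "count_S n = card (odd_part_1_mod_4 \<inter> {..n})"

lemma count_S_0: "count_S 0 = 0"
  by (simp add: count_S_def zero_notin_S)

lemma count_S_Suc:
  "count_S (Suc n) = count_S n + (if Suc n \<in> odd_part_1_mod_4 then 1 else 0)"
  by (simp add: count_S_def atMost_Suc Int_insert_right)

lemma mono_count_S: "mono count_S"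
  by (simp add: mono_iff_le_Suc count_S_Suc)

lemma count_S_shift:
  assumes "j < 2 ^ l"
  shows "count_S (2 ^ Suc l * m + j) = count_S (2 ^ Suc l * m) + count_S j"
  using assms
proof (induction j)
  case (Suc j)
  then show ?case
    using in_S_shift_iff[of "Suc j" l m] by (simp add: count_S_Suc)
qed (simp add: count_S_0)

text \<open>Even elements up to \<open>2 * n\<close> are doubles of elements up to \<open>n\<close>;
  the odd ones are the numbers 1 modulo 4.\<close>

lemma count_S_double: "count_S (2 * n) = count_S n + (n + 1) div 2"
proof (induction n)
  case (Suc n)
  have "Suc (2 * n) \<in> odd_part_1_mod_4 \<longleftrightarrow> even n"
    by (subst odd_in_S_iff) (simp, presburger)
  moreover have "Suc (Suc (2 * n)) \<in> odd_part_1_mod_4 \<longleftrightarrow> Suc n \<in> odd_part_1_mod_4"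
    using double_in_S_iff[of "Suc n"] by simp
  ultimately show ?case
    using Suc by (simp add: count_S_Suc)
qed (simp add: count_S_0)

text \<open>Iterating \<open>count_S_double\<close> adds the geometric sum
  \<open>(2 ^ l - 1) * m\<close>; the \<open>m\<close> on the left avoids a subtraction.\<close>

lemma count_S_power_mult:
  "count_S (2 ^ Suc l * m) + m = count_S (2 * m) + 2 ^ l * m"
proof (induction l)
  case (Suc l)
  have "count_S (2 ^ Suc (Suc l) * m) = count_S (2 * (2 ^ Suc l * m))"
    by (simp add: mult.assoc)
  also have "\<dots> = count_S (2 ^ Suc l * m) + 2 ^ l * m"
    by (subst count_S_double) simp
  finally show ?case
    using Suc by simp
qed simp

lemma count_S_power: "count_S (2 ^ Suc l) = 2 ^ l + 1"
proof -
  have "Suc 0 \<in> odd_part_1_mod_4"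
    by (subst odd_in_S_iff) simp_all
  then have "count_S (2 * 1) = 2"
    by (subst count_S_double) (simp add: count_S_Suc count_S_0)
  then show ?thesis
    using count_S_power_mult[of l 1] by simp
qed

text \<open>One of any four consecutive integers is 1 modulo 4. This bounds the gaps of
  \<open>a_seq\<close>, so that \<open>d_seq\<close> takes finitely many values.\<close>

lemma count_S_add_4: "count_S n < count_S (n + 4)"
proof -
  obtain i where i: "i < 4" "(n + Suc i) mod 4 = 1"
  proof -
    have "\<exists>i<4. (n + Suc i) mod 4 = 1"
      by presburger
    then show ?thesis
      using that by blast
  qed
  have "odd (n + Suc i)"
    using i(2) by presburger
  then have "count_S (n + Suc i) = count_S (n + i) + 1"
    using i(2) odd_in_S_iff[of "n + Suc i"] by (simp add: count_S_Suc)
  moreover have "count_S n \<le> count_S (n + i)" "count_S (n + Suc i) \<le> count_S (n + 4)"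
    using i(1) by (auto intro!: monoD[OF mono_count_S])
  ultimately show ?thesis
    by linarith
qed

lemma a_seq_in_S: "0 < n \<Longrightarrow> a_seq n \<in> odd_part_1_mod_4"
  using a_seq_image by (metis atLeast_iff imageI less_eq_Suc_le One_nat_def)

lemma count_S_a_seq: "count_S (a_seq n) = n"
proof -
  have "odd_part_1_mod_4 \<inter> {..a_seq n} = a_seq ` {1..n}"
    using strict_mono_less_eq[OF strict_mono_a_seq] by (auto simp flip: a_seq_image)
  moreover have "inj_on a_seq {1..n}"
    using strict_mono_imp_inj_on[OF strict_mono_a_seq] inj_on_subset by blast
  ultimately show ?thesis
    by (simp add: count_S_def card_image)
qed

lemma a_seq_count_S:
  assumes "m \<in> odd_part_1_mod_4"
  shows "a_seq (count_S m) = m"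
  using assms count_S_a_seq by (auto simp flip: a_seq_image)

lemma a_seq_Suc_le: "a_seq (Suc n) \<le> a_seq n + 4"
proof (rule ccontr)
  assume "\<not> ?thesis"
  then obtain x where x: "a_seq (Suc n) = Suc x" "a_seq n + 4 \<le> x"
    by (cases "a_seq (Suc n)") auto
  have "count_S (Suc x) = Suc (count_S x)"
    using a_seq_in_S[of "Suc n"] x(1) by (simp add: count_S_Suc)
  moreover have "n < count_S x"
    using count_S_add_4[of "a_seq n"] monoD[OF mono_count_S x(2)] by (simp add: count_S_a_seq)
  ultimately show False
    using count_S_a_seq[of "Suc n"] x(1) by simp
qed

lemma a_seq_le: "a_seq n \<le> 4 * n"
proof (induction n)
  case (Suc n)
  then show ?case
    using a_seq_Suc_le[of n] by simp
qed (simp add: a_seq_0)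

lemma d_seq_range: "d_seq n \<in> {0..4}"
  using a_seq_Suc_le[of n] strict_monoD[OF strict_mono_a_seq, of n "Suc n"]
  by (auto simp: d_seq_def)

section \<open>Repetitions in the difference sequence\<close>

text \<open>The base point \<open>2 ^ Suc l * m\<close> need not lie in the set itself, hence
  \<open>0 < n\<close>.\<close>

lemma a_seq_shift:
  assumes "0 < n" "a_seq n < 2 ^ l"
  shows "a_seq (count_S (2 ^ Suc l * m) + n) = 2 ^ Suc l * m + a_seq n"
proof -
  have "0 < a_seq n"
    using strict_monoD[OF strict_mono_a_seq assms(1)] by simp
  then have "2 ^ Suc l * m + a_seq n \<in> odd_part_1_mod_4"
    using in_S_shift_iff assms a_seq_in_S by blast
  moreover have "count_S (2 ^ Suc l * m + a_seq n) = count_S (2 ^ Suc l * m) + n"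
    using count_S_shift[OF assms(2)] by (simp add: count_S_a_seq)
  ultimately show ?thesis
    using a_seq_count_S by metis
qed

lemma d_seq_shift:
  assumes "0 < n" "4 * (n + 1) < 2 ^ l"
  shows "d_seq (count_S (2 ^ Suc l * m) + n) = d_seq n"
proof -
  have "a_seq (n + 1) < 2 ^ l" "a_seq n < 2 ^ l"
    using a_seq_le[of "n + 1"] a_seq_le[of n] assms(2) by simp_all
  then show ?thesis
    using a_seq_shift[of "n + 1" l m] a_seq_shift[of n l m] assms(1)
    by (simp add: d_seq_def add.assoc)
qed

lemma S_no_long_period:
  assumes "0 < P"
    and period: "\<And>x. b \<le> x \<Longrightarrow> x \<le> b + 3 * P \<Longrightarrow>
      x + P \<in> odd_part_1_mod_4 \<longleftrightarrow> x \<in> odd_part_1_mod_4"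
  shows False
proof -
  obtain v u where vu: "P = 2 ^ v * u" "odd u"
    using multiplicity_decompose'[of P "2::nat"] assms(1) by (metis less_irrefl odd_one)
  have v0: "0 < (2::nat) ^ v"
    by simp
  \<comment> \<open>\<open>2 ^ v * t\<close> is the first multiple of \<open>2 ^ v\<close> beyond
    \<open>b\<close>, and \<open>y\<close> rounds \<open>t\<close> up to an odd number. This keeps
    \<open>x\<close> within \<open>b + 2 * P\<close>, so the period applies at both \<open>x\<close>
    and \<open>x + P\<close>.\<close>
  define t where "t = b div 2 ^ v + 1"
  define y where "y = (if odd t then t else t + 1)"
  define x where "x = 2 ^ v * y"
  have "odd y"
    by (simp add: y_def)
  have "b < 2 ^ v * t"
    using dividend_less_times_div[OF v0, of b] by (simp add: t_def)
  also have "2 ^ v * t \<le> x"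
    by (simp add: x_def y_def)
  finally have "b \<le> x"
    by simp
  have "x \<le> 2 ^ v * (b div 2 ^ v + 2)"
    unfolding x_def y_def t_def by (intro mult_left_mono) auto
  also have "\<dots> \<le> b + 2 * 2 ^ v"
    using times_div_less_eq_dividend[of "2 ^ v" b] by (simp add: algebra_simps)
  also have "2 ^ v \<le> P"
    using vu by (cases u) auto
  finally have "x \<le> b + 2 * P"
    by simp
  then have "x + P + P \<in> odd_part_1_mod_4 \<longleftrightarrow> x \<in> odd_part_1_mod_4"
    using period[of x] period[of "x + P"] \<open>b \<le> x\<close> by auto
  moreover have "x + P + P = 2 ^ v * (y + 2 * u)"
    by (simp add: x_def vu algebra_simps)
  \<comment> \<open>\<open>2 * u\<close> is 2 modulo 4, so adding it swaps the odd residues 1 and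
    3.\<close>
  moreover have "(y + 2 * u) mod 4 = 1 \<longleftrightarrow> y mod 4 \<noteq> 1"
    using \<open>odd y\<close> vu(2) by presburger
  ultimately show False
    using \<open>odd y\<close> odd_in_S_iff[of y] odd_in_S_iff[of "y + 2 * u"]
    by (simp add: power_mult_in_S_iff x_def)
qed

text \<open>Summing differences turns the period \<open>p\<close> of \<open>d_seq\<close> into a
  translation of the set by \<open>P = a_seq (s + p) - a_seq s\<close>; the indices from
  \<open>s\<close> to \<open>s + 3 * p\<close> span exactly \<open>3 * P\<close>.\<close>

lemma d_seq_no_long_period:
  assumes "0 < p" "0 < s" "3 * p \<le> L"
    and period: "\<And>i. i < L \<Longrightarrow> d_seq (s + p + i) = d_seq (s + i)"
  shows False
proof (rule S_no_long_period)
  define P where "P = a_seq (s + p) - a_seq s"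
  have aP: "a_seq (s + p) = a_seq s + P"
    using strict_mono_less_eq[OF strict_mono_a_seq, of s "s + p"] by (simp add: P_def)
  have shift: "a_seq (s + p + i) = a_seq (s + i) + P" if "i \<le> L" for i
    using that
  proof (induction i)
    case (Suc i)
    then show ?case
      using period[of i] by (simp add: d_seq_def)
  qed (simp add: aP)
  show "0 < P"
    using strict_monoD[OF strict_mono_a_seq, of s "s + p"] assms(1) by (simp add: P_def)
  have a_end: "a_seq (s + 3 * p) = a_seq s + 3 * P"
    using shift[of p] shift[of "p + p"] assms(3) by (simp add: aP numeral_3_eq_3 add.assoc)
  fix x
  assume x: "a_seq s \<le> x" "x \<le> a_seq s + 3 * P"
  show "x + P \<in> odd_part_1_mod_4 \<longleftrightarrow> x \<in> odd_part_1_mod_4"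
  proof
    assume "x \<in> odd_part_1_mod_4"
    then obtain n where n: "x = a_seq n"
      using a_seq_count_S by metis
    then have "s \<le> n" "n \<le> s + 3 * p"
      using x strict_mono_less_eq[OF strict_mono_a_seq] by (simp_all flip: a_end)
    then have "x + P = a_seq (n + p)"
      using shift[of "n - s"] assms(3) n by (simp add: add.commute)
    then show "x + P \<in> odd_part_1_mod_4"
      using a_seq_in_S assms(1) by simp
  next
    assume "x + P \<in> odd_part_1_mod_4"
    then obtain n where n: "x + P = a_seq n"
      using a_seq_count_S by metis
    then have "a_seq (s + p) \<le> a_seq n" "a_seq n \<le> a_seq (s + 3 * p) + P"
      using x by (simp_all add: aP a_end)
    then have "a_seq (s + p) \<le> a_seq n" "a_seq n \<le> a_seq (s + p + 3 * p)"
      using shift[OF assms(3)] by simp_all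
    then have "s + p \<le> n" "n \<le> s + p + 3 * p"
      by (simp_all only: strict_mono_less_eq[OF strict_mono_a_seq])
    then have "a_seq n = a_seq (n - p) + P"
      using shift[of "n - p - s"] assms(3) by (simp add: add.commute)
    then show "x \<in> odd_part_1_mod_4"
      using n a_seq_in_S[of "n - p"] \<open>s + p \<le> n\<close> assms(2) by simp
  qed
qed

section \<open>Blocks of an automatic sequence\<close>

text \<open>The colour \<open>c m\<close> encodes the values at \<open>m\<close> of all kernel
  sequences, a finite amount of data. Every entry of a block is such a value, so one colouring
  serves all \<open>k\<close>.\<close>

lemma automatic_finite_blocks:
  assumes "automatic q x" "finite V" "\<And>n. x n \<in> V"
  obtains c :: "nat \<Rightarrow> nat" and B where "\<And>m. c m < B"
    "\<And>k m m' i. c m = c m' \<Longrightarrow> i < q ^ k \<Longrightarrow> x (q ^ k * m + i) = x (q ^ k * m' + i)"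
proof -
  define K where "K = kernel q x"
  define T where "T m = (\<lambda>f\<in>K. f m)" for m
  have "finite K"
    using assms(1) by (simp add: K_def automatic_def)
  then have "finite (K \<rightarrow>\<^sub>E V)"
    using assms(2) by (simp add: finite_PiE)
  moreover have "range T \<subseteq> K \<rightarrow>\<^sub>E V"
  proof -
    have "f m \<in> V" if "f \<in> K" for f m
      using that assms(3) by (auto simp: K_def kernel_def)
    then show ?thesis
      by (auto simp: T_def)
  qed
  ultimately have "finite (range T)"
    using finite_subset by blast
  then obtain h :: "_ \<Rightarrow> nat" and B where h: "h ` range T = {i. i < B}" "inj_on h (range T)"
    using finite_imp_inj_to_nat_seg[of "range T"] by blast
  show thesis
  proof (rule that[of "h \<circ> T" B])
    fix m
    show "(h \<circ> T) m < B"
      using h(1) by auto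
  next
    fix k m m' i
    assume "(h \<circ> T) m = (h \<circ> T) m'" "i < q ^ k"
    then have "T m = T m'"
      using h(2) by (auto dest: inj_onD)
    moreover have "(\<lambda>n. x (q ^ k * n + i)) \<in> K"
      using Suc_leI[OF \<open>i < q ^ k\<close>] unfolding K_def kernel_def by fastforce
    ultimately show "x (q ^ k * m + i) = x (q ^ k * m' + i)"
      unfolding T_def by (metis (no_types, lifting) restrict_apply')
  qed
qed

lemma not_automatic_d_seq:
  assumes "0 < q"
    and base_points: "\<And>n. \<exists>k l X. 8 * q ^ k < 2 ^ l \<and>
      inj_on (\<lambda>j. count_S (2 ^ Suc l * X j) mod q ^ k) {..<n::nat}"
  shows "\<not> automatic q d_seq"
proof
  assume "automatic q d_seq"
  obtain c :: "nat \<Rightarrow> nat" and B where c: "\<And>m. c m < B"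
    "\<And>k m m' i. c m = c m' \<Longrightarrow> i < q ^ k \<Longrightarrow> d_seq (q ^ k * m + i) = d_seq (q ^ k * m' + i)"
    by (rule automatic_finite_blocks
        [OF \<open>automatic q d_seq\<close> finite_atLeastAtMost_int d_seq_range]) blast
  obtain k l X where l: "8 * q ^ k < 2 ^ l"
    and inj: "inj_on (\<lambda>j. count_S (2 ^ Suc l * X j) mod q ^ k) {..<B * 3 + 1}"
    using base_points by blast
  define Q where "Q = q ^ k"
  have "0 < Q"
    using assms(1) by (simp add: Q_def)
  define A where "A j = count_S (2 ^ Suc l * X j)" for j
  have inj': "inj_on (\<lambda>j. A j mod Q) {..<B * 3 + 1}"
    using inj unfolding A_def Q_def .
  \<comment> \<open>The distance from \<open>A j\<close> to the next multiple
    \<open>Q * m j\<close>; it is \<open>Q\<close>, not 0, when \<open>Q\<close> divides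
    \<open>A j\<close>, because \<open>d_seq_shift\<close> needs a positive index.\<close>
  define r where "r j = Q - A j mod Q" for j
  define m where "m j = A j div Q + 1" for j
  have r: "0 < r j" "r j \<le> Q" "A j + r j = Q * m j" "A j mod Q = Q - r j" for j
  proof -
    have "A j mod Q < Q"
      using \<open>0 < Q\<close> by simp
    then show "0 < r j" "r j \<le> Q" "A j mod Q = Q - r j"
      by (simp_all add: r_def)
    show "A j + r j = Q * m j"
      using \<open>A j mod Q < Q\<close> mult_div_mod_eq[of Q "A j"]
      unfolding r_def m_def distrib_left by linarith
  qed
  \<comment> \<open>Pigeonhole on the block colour and on which third of the range from 1 to
    \<open>Q\<close> contains \<open>r j\<close>: at most \<open>B * 3\<close> classes for
    \<open>B * 3 + 1\<close> points.\<close>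
  define g where "g j = (c (m j), 3 * (r j - 1) div Q)" for j
  have "g ` {..<B * 3 + 1} \<subseteq> {..<B} \<times> {..<3}"
  proof -
    have "3 * (r j - 1) < 3 * Q" for j
      using r(1,2)[of j] by linarith
    then have "3 * (r j - 1) div Q < 3" for j
      by (simp add: less_mult_imp_div_less)
    then show ?thesis
      using c(1) by (auto simp: g_def)
  qed
  then have "card (g ` {..<B * 3 + 1}) \<le> B * 3"
    using card_mono[of "{..<B} \<times> {..<3::nat}"] by fastforce
  then have "\<not> inj_on g {..<B * 3 + 1}"
    by (intro pigeonhole) simp
  then obtain i j where ij: "i < B * 3 + 1" "j < B * 3 + 1" "i \<noteq> j" "g i = g j"
    unfolding inj_on_def by blast
  have "r i \<noteq> r j"
    using inj_onD[OF inj', of i j] ij r(4) by auto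
  have close_offsets: False if "g i = g j" "r i < r j" for i j
  proof (rule d_seq_no_long_period)
    show "0 < r j - r i" "0 < r i"
      using that r(1) by auto
    have "3 * (r j - 1) < Q * (3 * (r i - 1) div Q) + Q"
      using that(1) dividend_less_times_div[OF \<open>0 < Q\<close>, of "3 * (r j - 1)"]
      by (simp add: g_def)
    also have "\<dots> \<le> 3 * (r i - 1) + Q"
      by simp
    finally show "3 * (r j - r i) \<le> Q"
      using r(1)[of i] by linarith
    \<comment> \<open>Here \<open>r j + t + 1\<close> is at most \<open>2 * Q\<close>, which is
      where the factor 8 in the bound on \<open>2 ^ l\<close> comes from.\<close>
    have block: "d_seq (r j + t) = d_seq (Q * m j + t)" if "t < Q" for j t
    proof -
      have "d_seq (A j + (r j + t)) = d_seq (r j + t)"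
        unfolding A_def
        by (rule d_seq_shift) (use r(1,2)[of j] that l in \<open>auto simp flip: Q_def\<close>)
      then show ?thesis
        by (simp flip: r(3) add: add.assoc)
    qed
    fix t
    assume "t < Q"
    then show "d_seq (r i + (r j - r i) + t) = d_seq (r i + t)"
      using that c(2)[of "m j" "m i" t k] block[of t i] block[of t j]
      by (simp add: g_def Q_def)
  qed
  show False
    using close_offsets[of i j] close_offsets[of j i] ij \<open>r i \<noteq> r j\<close> by fastforce
qed

section \<open>Points whose counts are incongruent modulo a power of \<open>q\<close>\<close>

lemma base_points_power_2:
  assumes "0 < s"
  shows "\<exists>k l X. 8 * (2 ^ s) ^ k < (2 ^ l :: nat) \<and>
    inj_on (\<lambda>j. count_S (2 ^ Suc l * X j) mod (2 ^ s) ^ k) {..<n::nat}"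
proof -
  \<comment> \<open>\<open>X j\<close> is \<open>(4 ^ j - 1) / 3\<close>, with binary digits 1 and 0
    alternating.\<close>
  define X :: "nat \<Rightarrow> nat" where "X = rec_nat 0 (\<lambda>_ x. 4 * x + 1)"
  have X_simps: "X 0 = 0" "X (Suc j) = 4 * X j + 1" for j
    by (simp_all add: X_def)
  have X: "count_S (2 * X j) = X j + j" for j
  proof (induction j)
    case (Suc j)
    have "Suc (4 * X j) \<in> odd_part_1_mod_4"
      by (subst odd_in_S_iff) simp_all
    then have "count_S (X (Suc j)) = count_S (2 * (2 * X j)) + 1"
      by (simp add: X_simps count_S_Suc)
    also have "count_S (2 * (2 * X j)) = count_S (2 * X j) + X j"
      by (subst count_S_double) simp
    finally show ?case
      using Suc by (subst count_S_double) (simp add: X_simps)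
  qed (simp add: X_simps count_S_0)
  \<comment> \<open>The summand 4 gives \<open>2 ^ l = 16 * 2 ^ (s * n)\<close>, enough for the size
    bound, and makes \<open>2 ^ l * X j\<close> vanish modulo \<open>2 ^ (s * n)\<close>, leaving
    the residue \<open>j\<close>.\<close>
  define l where "l = s * n + 4"
  have pow: "(2 ^ s) ^ n = (2 ^ (s * n) :: nat)"
    by (simp add: power_mult)
  have "n < 2 ^ (s * n)"
    using assms le_less_trans[OF _ less_exp[of "s * n"]] by simp
  moreover have "count_S (2 ^ Suc l * X j) = 2 ^ l * X j + j" for j
    using count_S_power_mult[of l "X j"] X[of j] by simp
  moreover have "(2 ^ (s * n) :: nat) dvd 2 ^ l * X j" for j
    by (simp add: l_def le_imp_power_dvd)
  ultimately have "count_S (2 ^ Suc l * X j) mod (2 ^ s) ^ n = j" if "j < n" for j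
    using that by (simp add: pow mod_add_left_eq[symmetric, of "2 ^ l * X j"])
  then have "inj_on (\<lambda>j. count_S (2 ^ Suc l * X j) mod (2 ^ s) ^ n) {..<n}"
    by (auto simp: inj_on_def)
  moreover have "8 * (2 ^ s) ^ n < (2 ^ l :: nat)"
    by (simp add: pow l_def power_add)
  ultimately show ?thesis
    by blast
qed

text \<open>With \<open>X j = 2 ^ j\<close>, a congruence between the counts for
  \<open>i < j\<close> would force the odd number \<open>u ^ n\<close> to divide
  \<open>2 ^ (j - i) - 1\<close>, which is positive and smaller than \<open>u ^ n\<close>.\<close>

lemma base_points_not_power_2:
  assumes "q = 2 ^ s * u" "odd u" "1 < u"
  shows "\<exists>k l X. 8 * q ^ k < 2 ^ l \<and>
    inj_on (\<lambda>j. count_S (2 ^ Suc l * X j) mod q ^ k) {..<n::nat}"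
proof -
  obtain l where l: "8 * q ^ n < 2 ^ l"
    using less_exp by blast
  have "i = j" if "i \<le> j" "j < n" "(2 ^ (l + i) + 1) mod q ^ n = (2 ^ (l + j) + 1) mod q ^ n" for i j
  proof -
    have "q ^ n dvd (2 ^ (l + j) + 1) - (2 ^ (l + i) + 1)"
      using that by (metis mod_eq_dvd_iff_nat add_right_mono power_increasing
          nat_add_left_cancel_le one_le_numeral)
    also have "(2 ^ (l + j) + 1) - (2 ^ (l + i) + 1 :: nat) = 2 ^ (l + i) * (2 ^ (j - i) - 1)"
      using that(1) by (simp add: diff_mult_distrib2 flip: power_add)
    finally have "u ^ n dvd 2 ^ (l + i) * (2 ^ (j - i) - 1)"
      by (metis assms(1) dvd_mult_right power_mult_distrib)
    then have "u ^ n dvd 2 ^ (j - i) - 1"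
      using assms(2) by (simp add: coprime_dvd_mult_right_iff)
    moreover have "2 ^ (j - i) - 1 < u ^ n"
    proof -
      have "(2::nat) ^ (j - i) \<le> 2 ^ n"
        using that by (intro power_increasing) auto
      also have "\<dots> \<le> u ^ n"
        using assms(3) by (intro power_mono) auto
      finally have "2 ^ (j - i) \<le> u ^ n" .
      moreover have "(0::nat) < 2 ^ (j - i)"
        by simp
      ultimately show ?thesis
        by linarith
    qed
    ultimately have "(2::nat) ^ (j - i) - 1 = 0"
      using nat_dvd_not_less by blast
    then have "j - i = 0"
      using less_exp[of "j - i"] by linarith
    then show "i = j"
      using that(1) by simp
  qed
  then have "inj_on (\<lambda>j. (2 ^ (l + j) + 1) mod q ^ n) {..<n}"
    by (metis (no_types, lifting) inj_onI lessThan_iff linear)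
  moreover have "count_S (2 ^ Suc l * 2 ^ j) = 2 ^ (l + j) + 1" for j
    using count_S_power[of "l + j"] by (simp add: power_add mult.assoc)
  ultimately show ?thesis
    using l by (intro exI[of _ n] exI[of _ l] exI[of _ "\<lambda>j. 2 ^ j"]) simp
qed

theorem theorem13:
  fixes q :: nat
  assumes "q \<ge> 2"
  shows "\<not> automatic q d_seq"
proof -
  obtain s u where q: "q = 2 ^ s * u" "odd u"
    using multiplicity_decompose'[of q "2::nat"] assms
    by (metis not_numeral_le_zero odd_one)
  show ?thesis
  proof (cases "u = 1")
    case True
    then have "0 < s"
      using q assms by (cases s) auto
    then show ?thesis
      using base_points_power_2[OF \<open>0 < s\<close>] q(1) True assms
      by (intro not_automatic_d_seq) simp_all
  next
    case False
    then have "1 < u"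
      using q(2) by (cases u) auto
    then show ?thesis
      using base_points_not_power_2[OF q] assms by (intro not_automatic_d_seq) simp_all
  qed
qed

end
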